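(* Let $Q$ be the unit square and let $(x_0^0,\theta_0^0)$ be the initial condition of a periodic orbit $\mathscr{O}_Q(x_0^0,\theta_0^0)$ of the square billiard $\Omega(Q)$. Suppose that every element of the footprint $\mathcal{F}_Q(x_0^0,\theta_0^0)$ has an infinite binary expansion and no equivalent finite binary expansion, and that $(x_0^0,\theta_0^0)$ is then the initial condition of an orbit of $\Omega(\mathscr{T}_0)$ that constitutes the reflected-unfolding of $\mathscr{O}_Q(x_0^0,\theta_0^0)$ in $\Omega(\mathscr{T}_0)$. Put $\theta^0=\theta_0^0$. Then the sequence of compatible orbits $\{\mathscr{O}_n(x_n^0,\theta^0)\}_{n=0}^\infty$ of the prefractal billiards $\Omega(\mathscr{T}_n)$ determined by $(x_0^0,\theta^0)$ is a sequence of compatible periodic orbits, i.e. every orbit $\mathscr{O}_n(x_n^0,\theta^0)$, $n\ge 0$, is periodic.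
   Context: **Billiards.** For a polygon $D$, $\Omega(D)$ denotes the closed region bounded by $D$, regarded as a billiard table. A point moves at unit speed in straight lines and reflects off sides by the law of reflection. At a vertex with interior angle $\pi/2$ reflection is defined (the trajectory comes back along the path on which it arrived, by continuity); at a vertex with interior angle $3\pi/2$ it is not defined and the orbit is singular. An initial condition $(x^0,\theta^0)$ is a boundary basepoint together with an inward pointing direction (angle); $\mathscr{O}_D(x^0,\theta^0)$ is the resulting orbit. With $f_D$ the billiard map (taking a boundary point and inward direction to the next collision point and the reflected direction), the orbit is periodic if reflection is well defined at each of its basepoints and $f_D^m(x^0,\theta^0)=(x^0,\theta^0)$ for some $m\geq 1$. The footprint $\mathcal{F}_D(x^0,\theta^0)$ is the set of points of the orbit lying on the boundary $D$. For $D=Q$, an element of the footprint is identified with its position in $[0,1]$ along the side of $Q$ containing it; having an infinite binary expansion and no equivalent finite one means that this position is not a dyadic rational. **The T-fractal prefractals.** $\mathscr{T}_0$ is the boundary of a T-shaped region made of eight unit squares: a stem $[0,2]\times[0,2]$ of width $2$ and height $2$, on top of which sits the bar $[-1,3]\times[2,3]$. Its base is the segment $[0,2]\times\{0\}$. For $n\ge0$, $\Omega(\mathscr{T}_{n+1})$ is obtained from $\Omega(\mathscr{T}_n)$ by attaching $2^{n+1}$ copies of the T-shape scaled by $2^{-(n+1)}$: on top of the bar of each scaled T-shape added at stage $n$ (for $n=0$, the initial T-shape itself), two such copies are attached, their bases (of length $2\cdot2^{-(n+1)}$) being glued to the leftmost quarter and the rightmost quarter of the top edge of the bar, these base segments being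 removed from the boundary. $\mathscr{T}_{n+1}$ is the boundary of the resulting region. **Reflected-unfolding.** $\Omega(\mathscr{T}_0)$ is tiled by unit squares obtained from one tile, identified with $Q$, by successive reflections in sides. The reflected-unfolding in $\Omega(\mathscr{T}_0)$ of an orbit of $\Omega(Q)$ is obtained by unfolding the orbit (reflecting the square and the orbit in the sides which the orbit hits) along the tiles of $\Omega(\mathscr{T}_0)$, and, whenever the unfolded path meets the boundary $\mathscr{T}_0$, continuing in the direction given by the law of reflection, the orbit in $Q$ being traversed as many times as needed. **Compatible orbits.** Let $n>m$, and let $(x_n^0,\theta_n^0)$, $(x_m^0,\theta_m^0)$ be initial conditions, both inward pointing, of orbits of $\Omega(\mathscr{T}_n)$ and $\Omega(\mathscr{T}_m)$. They are compatible if $\theta_n^0=\theta_m^0$ and $x_n^0$, $x_m^0$ lie on a segment in this direction that meets the boundary $\mathscr{T}_n$ only at $x_n^0$. A sequence of compatible orbits is a sequence of orbits $\mathscr{O}_n(x_n^0,\theta^0)$ of $\Omega(\mathscr{T}_n)$ whose initial conditions are pairwise compatible; it is determined by its first initial condition. *)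

theory Defs
  imports "HOL-Analysis.Analysis"
begin

section \<open>Billiards in planar regions\<close>

text \<open>A polygon \<open>D\<close> is represented by the closed region \<open>\<Omega>\<close> that it bounds; thus
  \<open>D = frontier \<Omega>\<close>. A phase point consists of a point and a unit vector. The unit vector
  of an angle is \<open>angle_dir\<close>, so angles are compared modulo \<open>2 * pi\<close>.\<close>

type_synonym point = "real \<times> real"
type_synonym phase = "point \<times> point"

definition angle_dir :: "real \<Rightarrow> point" where
  "angle_dir \<theta> = (cos \<theta>, sin \<theta>)"

definition initial_condition :: "point set \<Rightarrow> phase \<Rightarrow> bool" where
  "initial_condition \<Omega> z \<longleftrightarrow>
     fst z \<in> frontier \<Omega> \<and> norm (snd z) = 1 \<and>
     (\<exists>\<epsilon>>0. \<forall>t. 0 < t \<and> t < \<epsilon> \<longrightarrow> fst z + t *\<^sub>R snd z \<in> interior \<Omega>)"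

text \<open>Near \<open>x\<close> the region is a half plane with inner unit normal \<open>\<nu>\<close>: \<open>x\<close> is in the relative
  interior of a side.\<close>

definition flat_at :: "point set \<Rightarrow> point \<Rightarrow> point \<Rightarrow> bool" where
  "flat_at \<Omega> x \<nu> \<longleftrightarrow> norm \<nu> = 1 \<and>
     (\<exists>r>0. \<Omega> \<inter> ball x r = {y \<in> ball x r. 0 \<le> (y - x) \<bullet> \<nu>})"

text \<open>Near \<open>x\<close> the region is a quarter plane: \<open>x\<close> is a vertex with interior angle \<open>pi / 2\<close>.\<close>

definition right_corner_at :: "point set \<Rightarrow> point \<Rightarrow> bool" where
  "right_corner_at \<Omega> x \<longleftrightarrow> (\<exists>\<mu> \<nu>. norm \<mu> = 1 \<and> norm \<nu> = 1 \<and> \<mu> \<bullet> \<nu> = 0 \<and>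
     (\<exists>r>0. \<Omega> \<inter> ball x r = {y \<in> ball x r. 0 \<le> (y - x) \<bullet> \<mu> \<and> 0 \<le> (y - x) \<bullet> \<nu>}))"

definition inner_normal :: "point set \<Rightarrow> point \<Rightarrow> point" where
  "inner_normal \<Omega> x = (THE \<nu>. flat_at \<Omega> x \<nu>)"

text \<open>In particular reflection is not defined at a vertex with interior angle \<open>3 * pi / 2\<close>.\<close>

definition reflection_defined :: "point set \<Rightarrow> point \<Rightarrow> bool" where
  "reflection_defined \<Omega> x \<longleftrightarrow> (\<exists>\<nu>. flat_at \<Omega> x \<nu>) \<or> right_corner_at \<Omega> x"

definition reflected_dir :: "point set \<Rightarrow> point \<Rightarrow> point \<Rightarrow> point" where
  "reflected_dir \<Omega> x v =
     (if \<exists>\<nu>. flat_at \<Omega> x \<nu> then v - (2 * (v \<bullet> inner_normal \<Omega> x)) *\<^sub>R inner_normal \<Omega> x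
      else if right_corner_at \<Omega> x then - v
      else undefined)"

text \<open>For an inward pointing direction and compact \<open>\<Omega>\<close> the infimum is a positive minimum.\<close>

definition hit_time :: "point set \<Rightarrow> phase \<Rightarrow> real" where
  "hit_time \<Omega> z = Inf {t. 0 < t \<and> fst z + t *\<^sub>R snd z \<in> frontier \<Omega>}"

definition billiard_map :: "point set \<Rightarrow> phase \<Rightarrow> phase" where
  "billiard_map \<Omega> z =
     (let y = fst z + hit_time \<Omega> z *\<^sub>R snd z in (y, reflected_dir \<Omega> y (snd z)))"

definition billiard_orbit :: "point set \<Rightarrow> phase \<Rightarrow> nat \<Rightarrow> phase" where
  "billiard_orbit \<Omega> z k = (billiard_map \<Omega> ^^ k) z"

definition periodic_orbit :: "point set \<Rightarrow> phase \<Rightarrow> bool" where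
  "periodic_orbit \<Omega> z \<longleftrightarrow>
     (\<forall>k. reflection_defined \<Omega> (fst (billiard_orbit \<Omega> z k))) \<and>
     (\<exists>m\<ge>1. billiard_orbit \<Omega> z m = z)"

definition footprint :: "point set \<Rightarrow> phase \<Rightarrow> point set" where
  "footprint \<Omega> z = {fst (billiard_orbit \<Omega> z k) | k. True}"


section \<open>The prefractals\<close>

text \<open>The T-shape of scale \<open>s\<close> with base \<open>[a, a + 2s] \<times> {b}\<close>, where \<open>p = (a, b)\<close>.\<close>

definition T_shape :: "real \<Rightarrow> point \<Rightarrow> point set" where
  "T_shape s p = (case p of (a, b) \<Rightarrow>
     {a .. a + 2 * s} \<times> {b .. b + 2 * s} \<union>
     {a - s .. a + 3 * s} \<times> {b + 2 * s .. b + 3 * s})"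

text \<open>Left end points of the bases of the T-shapes of scale \<open>1 / 2 ^ n\<close> added at stage \<open>n\<close>.\<close>

fun T_bases :: "nat \<Rightarrow> point set" where
  "T_bases 0 = {(0, 0)}"
| "T_bases (Suc n) =
     (\<Union>(a, b)\<in>T_bases n. let s = 1 / 2 ^ n in {(a - s, b + 3 * s), (a + 2 * s, b + 3 * s)})"

text \<open>The closed region; the prefractal itself is its frontier, from which the glued base
  segments have disappeared.\<close>

fun T_region :: "nat \<Rightarrow> point set" where
  "T_region 0 = T_shape 1 (0, 0)"
| "T_region (Suc n) = T_region n \<union> (\<Union>p\<in>T_bases (Suc n). T_shape (1 / 2 ^ Suc n) p)"


section \<open>The unit square and reflected-unfolding\<close>

definition unit_square :: "point \<Rightarrow> point set" where
  "unit_square c = {fst c .. fst c + 1} \<times> {snd c .. snd c + 1}"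

text \<open>Lower left corners of the eight unit square tiles of \<open>T_region 0\<close>.\<close>

definition tile_corner :: "point \<Rightarrow> bool" where
  "tile_corner c \<longleftrightarrow> fst c \<in> \<int> \<and> snd c \<in> \<int> \<and> unit_square c \<subseteq> T_region 0"

definition dyadic_rational :: "real \<Rightarrow> bool" where
  "dyadic_rational s \<longleftrightarrow> (\<exists>(k::int) (n::nat). s = of_int k / 2 ^ n)"

text \<open>The positions in \<open>[0, 1]\<close> of a boundary point of \<open>unit_square c\<close> along the sides that
  contain it (two sides if the point is a corner).\<close>

definition side_positions :: "point \<Rightarrow> point \<Rightarrow> real set" where
  "side_positions c p =
     {s. snd p \<in> {snd c, snd c + 1} \<and> s = fst p - fst c \<or>
         fst p \<in> {fst c, fst c + 1} \<and> s = snd p - snd c}"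

text \<open>Reflection in the line through \<open>q\<close> with unit normal \<open>\<nu>\<close>.\<close>

definition mirror :: "point \<Rightarrow> point \<Rightarrow> point \<Rightarrow> point" where
  "mirror q \<nu> p = p - (2 * ((p - q) \<bullet> \<nu>)) *\<^sub>R \<nu>"

text \<open>The \<open>k\<close>-th map is the isometry carrying \<open>Q\<close> onto the tile of \<open>\<Omega>\<close> in which the \<open>k\<close>-th
  segment of the orbit of \<open>z\<close> in \<open>Q\<close> is drawn. If the end point of this segment is not
  on the boundary of \<open>\<Omega>\<close>, tile and orbit are reflected in the side of the tile that was hit, so
  the drawn path continues straight. If it is on the boundary, the tile is kept, so the drawn
  path is reflected there exactly as the orbit in \<open>Q\<close> is.\<close>

fun unfolding_map :: "point set \<Rightarrow> point set \<Rightarrow> phase \<Rightarrow> nat \<Rightarrow> point \<Rightarrow> point" where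
  "unfolding_map \<Omega> Q z 0 = id"
| "unfolding_map \<Omega> Q z (Suc k) =
     (let g = unfolding_map \<Omega> Q z k;
          y = g (fst (billiard_orbit Q z (Suc k)))
      in if y \<in> frontier \<Omega> then g else mirror y (inner_normal (g ` Q) y) \<circ> g)"

text \<open>The second component is the linear part of the affine map \<open>g\<close> applied to the direction.\<close>

definition unfolded_phase :: "point set \<Rightarrow> point set \<Rightarrow> phase \<Rightarrow> nat \<Rightarrow> phase" where
  "unfolded_phase \<Omega> Q z k =
     (let g = unfolding_map \<Omega> Q z k; w = billiard_orbit Q z k
      in (g (fst w), g (fst w + snd w) - g (fst w)))"

text \<open>The orbit of \<open>z\<close> in \<open>\<Omega>\<close> is the reflected-unfolding of the orbit of \<open>z\<close> in \<open>Q\<close>: its phase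
  points are, in order, those of the unfolded path at the times when this path is on the
  boundary of \<open>\<Omega>\<close>.\<close>

definition reflected_unfolding :: "point set \<Rightarrow> point set \<Rightarrow> phase \<Rightarrow> bool" where
  "reflected_unfolding \<Omega> Q z \<longleftrightarrow>
     (\<exists>r :: nat \<Rightarrow> nat. strict_mono r \<and>
        range r = {k. fst (unfolded_phase \<Omega> Q z k) \<in> frontier \<Omega>} \<and>
        (\<forall>j. billiard_orbit \<Omega> z j = unfolded_phase \<Omega> Q z (r j)))"


section \<open>Compatible orbits\<close>

definition compatible :: "nat \<Rightarrow> phase \<Rightarrow> nat \<Rightarrow> phase \<Rightarrow> bool" where
  "compatible n zn m zm \<longleftrightarrow>
     m < n \<and> initial_condition (T_region n) zn \<and> initial_condition (T_region m) zm \<and>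
     snd zn = snd zm \<and>
     (\<exists>p l. 0 \<le> l \<and>
        (let S = closed_segment p (p + l *\<^sub>R snd zn)
         in fst zn \<in> S \<and> fst zm \<in> S \<and> S \<inter> frontier (T_region n) = {fst zn}))"

definition compatible_sequence :: "(nat \<Rightarrow> phase) \<Rightarrow> bool" where
  "compatible_sequence z \<longleftrightarrow>
     (\<forall>n. initial_condition (T_region n) (z n)) \<and>
     (\<forall>m n. m < n \<longrightarrow> compatible n (z n) m (z m))"

end

theory Submission
  imports Defs
begin

text \<open>
  A billiard orbit in a region made of axis-parallel cells of side \<open>s\<close> is a folded straight line:
  every reflection changes the sign of one coordinate and shifts it by a multiple of \<open>s\<close>
  (\<open>billiard_orbit_unfolds\<close>). Everything is therefore read off from one line in the plane.

  Periodicity in the square makes the slope of this line rational: its direction is a multiple of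
  \<open>(P, Q)\<close> with coprime integers \<open>P\<close> and \<open>Q\<close>. The number \<open>J = Q x - P y\<close> is constant along the line,
  and it is not dyadic. For if it were, one could solve a linear congruence modulo the odd part of
  \<open>P\<close> to find a point of the line with one integral and one dyadic coordinate
  (\<open>rational_line_dyadic_crossing\<close>); it folds to a footprint point at a dyadic position
  (\<open>square_periodic_orbit_rational_line\<close>).

  The compatible initial conditions all lie on this line, so \<open>J\<close> has the same value for all of them.
  The \<open>n\<close>-th prefractal region is a union of cells of side \<open>1 / 2 ^ n\<close> (\<open>grid_region_T_region\<close>), and
  its vertices are grid points. A line through a grid point would have \<open>J\<close> in
  \<open>(1 / 2 ^ n) \<int>\<close>, so the orbit never meets a vertex. Moreover an orbit point on the boundary
  has one coordinate in the grid, and \<open>J\<close> then determines the other one up to grid multiples, so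
  the orbit visits only finitely many phase points. As the billiard map is injective there
  (\<open>billiard_map_inj\<close>), the orbit returns to its start (\<open>periodic_orbit_rational_line\<close>).
\<close>

section \<open>Billiard map near flat boundary points\<close>

lemma flat_at_interior_frontier:
  assumes "flat_at \<Omega> x \<nu>"
  obtains r where "r > 0"
    and "\<forall>y \<in> ball x r. y \<in> interior \<Omega> \<longleftrightarrow> 0 < (y - x) \<bullet> \<nu>"
    and "\<forall>y \<in> ball x r. y \<in> \<Omega> \<longleftrightarrow> 0 \<le> (y - x) \<bullet> \<nu>"
proof -
  from assms obtain r where r: "r > 0" "norm \<nu> = 1"
    and eq: "\<Omega> \<inter> ball x r = {y \<in> ball x r. 0 \<le> (y - x) \<bullet> \<nu>}"
    unfolding flat_at_def by blast
  have hs: "{y. \<nu> \<bullet> y \<ge> \<nu> \<bullet> x} = {y. 0 \<le> (y - x) \<bullet> \<nu>}"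
    by (simp add: inner_diff_left inner_commute[of \<nu>])
  have "interior \<Omega> \<inter> ball x r = interior (\<Omega> \<inter> ball x r)"
    by (simp add: interior_open)
  also have "\<dots> = interior ({y. \<nu> \<bullet> y \<ge> \<nu> \<bullet> x} \<inter> ball x r)"
    unfolding eq hs by (rule arg_cong[where f = interior]) auto
  also have "\<dots> = {y. \<nu> \<bullet> y > \<nu> \<bullet> x} \<inter> ball x r"
    using r(2) by (subst interior_Int, subst interior_halfspace_ge) (auto simp: interior_open)
  finally have int: "interior \<Omega> \<inter> ball x r = {y. \<nu> \<bullet> y > \<nu> \<bullet> x} \<inter> ball x r" .
  show thesis
  proof (rule that[OF r(1)]; intro ballI)
    fix y assume y: "y \<in> ball x r"
    then have "y \<in> interior \<Omega> \<longleftrightarrow> \<nu> \<bullet> y > \<nu> \<bullet> x" using int by blast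
    then show "y \<in> interior \<Omega> \<longleftrightarrow> 0 < (y - x) \<bullet> \<nu>"
      by (simp add: inner_diff_left inner_commute[of \<nu>])
  next
    fix y assume y: "y \<in> ball x r"
    show "y \<in> \<Omega> \<longleftrightarrow> 0 \<le> (y - x) \<bullet> \<nu>" using eq y by blast
  qed
qed

lemma flat_at_frontier:
  assumes "flat_at \<Omega> x \<nu>"
  shows "x \<in> frontier \<Omega>"
proof -
  obtain r where r: "r > 0"
    and i: "\<forall>y \<in> ball x r. y \<in> interior \<Omega> \<longleftrightarrow> 0 < (y - x) \<bullet> \<nu>"
    and m: "\<forall>y \<in> ball x r. y \<in> \<Omega> \<longleftrightarrow> 0 \<le> (y - x) \<bullet> \<nu>"
    by (rule flat_at_interior_frontier[OF assms])
  have "x \<in> \<Omega>" "x \<notin> interior \<Omega>" using r i m by auto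
  then show ?thesis unfolding frontier_def using closure_subset by blast
qed

text \<open>If two half planes with different unit normals \<open>\<mu>\<close> and \<open>\<nu>\<close> agreed near \<open>x\<close>, the point
  \<open>x + e (\<nu> - \<mu>)\<close> would lie in exactly one of them.\<close>

lemma inner_normal_eq:
  assumes "flat_at \<Omega> x \<nu>"
  shows "inner_normal \<Omega> x = \<nu>"
  unfolding inner_normal_def
proof (rule the_equality, rule assms, rule ccontr)
  fix \<mu> assume mu: "flat_at \<Omega> x \<mu>" and ne: "\<mu> \<noteq> \<nu>"
  have n: "norm \<mu> = 1" "norm \<nu> = 1" using mu assms by (auto simp: flat_at_def)
  obtain r where r: "r > 0"
    and "\<forall>y \<in> ball x r. y \<in> interior \<Omega> \<longleftrightarrow> 0 < (y - x) \<bullet> \<nu>"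
    and m: "\<forall>y \<in> ball x r. y \<in> \<Omega> \<longleftrightarrow> 0 \<le> (y - x) \<bullet> \<nu>"
    by (rule flat_at_interior_frontier[OF assms])
  obtain r' where r': "r' > 0"
    and "\<forall>y \<in> ball x r'. y \<in> interior \<Omega> \<longleftrightarrow> 0 < (y - x) \<bullet> \<mu>"
    and m': "\<forall>y \<in> ball x r'. y \<in> \<Omega> \<longleftrightarrow> 0 \<le> (y - x) \<bullet> \<mu>"
    by (rule flat_at_interior_frontier[OF mu])
  have sq: "\<mu> \<bullet> \<mu> = 1" "\<nu> \<bullet> \<nu> = 1" using n by (simp_all add: norm_eq_1)
  have "0 < (\<mu> - \<nu>) \<bullet> (\<mu> - \<nu>)" using ne by simp
  then have lt: "\<mu> \<bullet> \<nu> < 1"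
    using sq by (simp add: inner_diff_left inner_diff_right inner_commute)
  define e where "e = min r r' / 4"
  have e: "e > 0" "e < r / 2" "e < r' / 2" using r r' by (auto simp: e_def)
  define y where "y = x + e *\<^sub>R (\<nu> - \<mu>)"
  have "norm (\<nu> - \<mu>) \<le> 2" using norm_triangle_ineq4[of \<nu> \<mu>] n by simp
  then have "e * norm (\<nu> - \<mu>) \<le> e * 2" using e by (intro mult_left_mono) auto
  then have "dist x y < r" "dist x y < r'"
    using e unfolding y_def dist_commute[of x] by (simp only: dist_norm add_diff_cancel_left' norm_scaleR abs_of_pos; linarith)+
  then have "0 \<le> (y - x) \<bullet> \<nu> \<longleftrightarrow> 0 \<le> (y - x) \<bullet> \<mu>"
    using m[rule_format, of y] m'[rule_format, of y] by simp
  then have "0 \<le> e * (1 - \<mu> \<bullet> \<nu>) \<longleftrightarrow> 0 \<le> e * (\<mu> \<bullet> \<nu> - 1)"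
    using sq by (simp add: y_def inner_diff_left inner_diff_right inner_commute)
  then show False using e lt by (simp add: zero_le_mult_iff)
qed

text \<open>This is stronger than the corresponding part of an initial condition, which may also sit at a
  vertex; it is the property that the billiard map preserves as long as no vertex is met.\<close>

definition inward :: "point set \<Rightarrow> phase \<Rightarrow> bool" where
  "inward \<Omega> z \<longleftrightarrow> (\<exists>\<nu>. flat_at \<Omega> (fst z) \<nu> \<and> 0 < snd z \<bullet> \<nu>)"

text \<open>Near \<open>x\<close> the region is a half plane, so whether a short ray runs in the interior depends only
  on the sign of \<open>d \<bullet> \<nu>\<close>. The lemma is used for the outgoing ray and, reversed in time, for the
  incoming one.\<close>

lemma flat_at_ray_in_interior_iff:
  assumes "flat_at \<Omega> x \<nu>"
  shows "(\<exists>e>0. \<forall>t. 0 < t \<and> t < e \<longrightarrow> x + t *\<^sub>R d \<in> interior \<Omega>) \<longleftrightarrow> 0 < d \<bullet> \<nu>"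
proof -
  obtain r where r: "r > 0"
    and i: "\<forall>y \<in> ball x r. y \<in> interior \<Omega> \<longleftrightarrow> 0 < (y - x) \<bullet> \<nu>"
    and "\<forall>y \<in> ball x r. y \<in> \<Omega> \<longleftrightarrow> 0 \<le> (y - x) \<bullet> \<nu>"
    by (rule flat_at_interior_frontier[OF assms])
  \<comment> \<open>The added \<open>1\<close> only guards against \<open>d = 0\<close>.\<close>
  define e0 where "e0 = r / (norm d + 1)"
  have np: "norm d + 1 > 0" by (simp add: add_nonneg_pos)
  have e0: "e0 > 0" using r np by (simp add: e0_def)
  have near: "x + t *\<^sub>R d \<in> interior \<Omega> \<longleftrightarrow> 0 < d \<bullet> \<nu>" if "0 < t" "t < e0" for t
  proof -
    have "t * norm d \<le> t * (norm d + 1)" using that by simp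
    also have "\<dots> < r" using that np by (simp add: e0_def pos_less_divide_eq)
    finally have "x + t *\<^sub>R d \<in> ball x r" using that by (simp add: dist_norm)
    with i show ?thesis using that by (simp add: zero_less_mult_iff)
  qed
  show ?thesis
  proof
    assume "\<exists>e>0. \<forall>t. 0 < t \<and> t < e \<longrightarrow> x + t *\<^sub>R d \<in> interior \<Omega>"
    then obtain e where e: "e > 0" "\<forall>t. 0 < t \<and> t < e \<longrightarrow> x + t *\<^sub>R d \<in> interior \<Omega>" by blast
    have "0 < min e e0 / 2" "min e e0 / 2 < e" "min e e0 / 2 < e0"
      using e e0 by auto
    then show "0 < d \<bullet> \<nu>" using near[of "min e e0 / 2"] e by blast
  qed (use near e0 in blast)
qed

text \<open>The set of hitting times is nonempty because the ray leaves the bounded region, and it stays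
  away from \<open>0\<close> because the ray starts inwards; being closed, it contains its infimum.\<close>

lemma hit_time_first_exit:
  assumes "compact \<Omega>" "inward \<Omega> z"
  shows "0 < hit_time \<Omega> z"
    and "fst z + hit_time \<Omega> z *\<^sub>R snd z \<in> frontier \<Omega>"
    and "\<And>t. 0 < t \<Longrightarrow> t < hit_time \<Omega> z \<Longrightarrow> fst z + t *\<^sub>R snd z \<in> interior \<Omega>"
proof -
  define x d where "x = fst z" and "d = snd z"
  define ray where "ray t = x + t *\<^sub>R d" for t
  have cont: "continuous_on A ray" for A
    unfolding ray_def by (intro continuous_intros)
  obtain \<nu> where fl: "flat_at \<Omega> x \<nu>" and pos: "0 < d \<bullet> \<nu>"
    using assms(2) by (auto simp: inward_def x_def d_def)
  obtain e where e: "e > 0" "\<And>t. 0 < t \<Longrightarrow> t < e \<Longrightarrow> ray t \<in> interior \<Omega>"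
    using pos flat_at_ray_in_interior_iff[OF fl, of d] unfolding ray_def by blast
  have d0: "norm d > 0" using pos by auto
  \<comment> \<open>A ray segment that starts inside and avoids the frontier stays inside.\<close>
  have seg: "\<exists>t'. e / 2 \<le> t' \<and> t' \<le> t \<and> ray t' \<in> frontier \<Omega>"
    if "e / 2 \<le> t" "ray t \<notin> interior \<Omega>" for t
  proof -
    have "connected (ray ` {e / 2..t})"
      by (intro connected_continuous_image cont) simp
    moreover have "ray (e / 2) \<in> ray ` {e / 2..t}" "ray t \<in> ray ` {e / 2..t}"
      using that e(1) by (intro imageI; simp)+
    moreover have "ray (e / 2) \<in> interior \<Omega>" using e(1) e(2)[of "e / 2"] by simp
    ultimately have "connected (ray ` {e / 2..t})" "ray ` {e / 2..t} \<inter> interior \<Omega> \<noteq> {}"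
      "ray ` {e / 2..t} - interior \<Omega> \<noteq> {}"
      using that(2) by blast+
    then have "ray ` {e / 2..t} \<inter> frontier (interior \<Omega>) \<noteq> {}"
      by (rule connected_Int_frontier)
    then show ?thesis using frontier_interior_subset by fastforce
  qed
  define S where "S = {t. 0 < t \<and> ray t \<in> frontier \<Omega>}"
  have hit: "hit_time \<Omega> z = Inf S"
    by (simp add: hit_time_def S_def ray_def x_def d_def)
  have disj: "y \<notin> frontier \<Omega>" if "y \<in> interior \<Omega>" for y
    using that by (simp add: frontier_def)
  have "e \<le> t" if "0 < t" "ray t \<in> frontier \<Omega>" for t
    using that e(2)[of t] disj not_less by blast
  then have Se: "S = {e..} \<inter> ray -` frontier \<Omega>"
    unfolding S_def using less_le_trans[OF e(1)] by blast
  have "closed S" unfolding Se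
    using cont[of UNIV] by (intro closed_Int closed_atLeast continuous_closed_vimage)
      (auto simp: continuous_on_eq_continuous_at)
  have bdd: "bdd_below S" by (rule bdd_belowI[of _ e]) (auto simp: Se)
  obtain B where B: "\<And>y. y \<in> \<Omega> \<Longrightarrow> norm y \<le> B"
    using compact_imp_bounded[OF assms(1)] unfolding bounded_iff by blast
  \<comment> \<open>At time \<open>M\<close> the ray has travelled beyond the bound \<open>B\<close> of the region.\<close>
  define M where "M = max (e / 2) ((norm x + \<bar>B\<bar> + 1) / norm d)"
  have M0: "M \<ge> 0" using e by (simp add: M_def le_max_iff_disj)
  have "(norm x + \<bar>B\<bar> + 1) / norm d \<le> M" by (simp add: M_def)
  then have "norm x + \<bar>B\<bar> + 1 \<le> M * norm d" using d0 by (simp add: pos_divide_le_eq)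
  also have "M * norm d \<le> norm (ray M) + norm x"
    using norm_triangle_ineq4[of "ray M" x] M0 by (simp add: ray_def)
  finally have "ray M \<notin> \<Omega>" using B[of "ray M"] by fastforce
  then have "ray M \<notin> interior \<Omega>" using interior_subset by blast
  moreover have "e / 2 \<le> M" by (simp add: M_def)
  ultimately have "S \<noteq> {}" using seg[of M] e by (force simp: S_def)
  then have in_S: "hit_time \<Omega> z \<in> S"
    unfolding hit using closed_contains_Inf[OF _ bdd \<open>closed S\<close>] by blast
  then show "0 < hit_time \<Omega> z" "fst z + hit_time \<Omega> z *\<^sub>R snd z \<in> frontier \<Omega>"
    by (auto simp: S_def ray_def x_def d_def)
  show "fst z + t *\<^sub>R snd z \<in> interior \<Omega>" if t: "0 < t" "t < hit_time \<Omega> z" for t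
  proof (rule ccontr)
    assume n: "fst z + t *\<^sub>R snd z \<notin> interior \<Omega>"
    then have n': "ray t \<notin> interior \<Omega>" by (simp add: ray_def x_def d_def)
    then have "\<not> t < e" using e(2) t(1) by blast
    with e(1) have "e / 2 \<le> t" by simp
    from seg[OF this n'] obtain t' where t': "e / 2 \<le> t'" "t' \<le> t" "ray t' \<in> frontier \<Omega>" by blast
    then have "t' \<in> S" using e by (auto simp: S_def)
    then have "hit_time \<Omega> z \<le> t'" unfolding hit using bdd by (rule cInf_lower)
    then show False using t' t by simp
  qed
qed

lemma fst_billiard_map: "fst (billiard_map \<Omega> z) = fst z + hit_time \<Omega> z *\<^sub>R snd z"
  by (simp add: billiard_map_def Let_def)

lemma snd_billiard_map_flat:
  assumes "flat_at \<Omega> (fst (billiard_map \<Omega> z)) \<nu>"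
  shows "snd (billiard_map \<Omega> z) = snd z - (2 * (snd z \<bullet> \<nu>)) *\<^sub>R \<nu>"
proof -
  have "\<exists>\<nu>. flat_at \<Omega> (fst (billiard_map \<Omega> z)) \<nu>" using assms by blast
  then show ?thesis using inner_normal_eq[OF assms]
    by (simp add: billiard_map_def Let_def reflected_dir_def del: split_paired_Ex)
qed

text \<open>Followed backwards, the segment that ends at the hit point runs in the interior, so the incoming
  direction points outwards; reflection reverses its normal component.\<close>

lemma inward_billiard_map:
  assumes "compact \<Omega>" "inward \<Omega> z" "flat_at \<Omega> (fst (billiard_map \<Omega> z)) \<nu>"
  shows "inward \<Omega> (billiard_map \<Omega> z)"
proof -
  note h = hit_time_first_exit[OF assms(1,2)]
  have "\<exists>e>0. \<forall>t. 0 < t \<and> t < e \<longrightarrow>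
      fst (billiard_map \<Omega> z) + t *\<^sub>R (- snd z) \<in> interior \<Omega>"
  proof (intro exI[of _ "hit_time \<Omega> z"] conjI allI impI h(1))
    fix t assume t: "0 < t \<and> t < hit_time \<Omega> z"
    then show "fst (billiard_map \<Omega> z) + t *\<^sub>R (- snd z) \<in> interior \<Omega>"
      using h(3)[of "hit_time \<Omega> z - t"] by (simp add: fst_billiard_map algebra_simps)
  qed
  then have "0 < (- snd z) \<bullet> \<nu>"
    using flat_at_ray_in_interior_iff[OF assms(3)] by blast
  moreover have "\<nu> \<bullet> \<nu> = 1" using assms(3) by (simp add: flat_at_def norm_eq_1)
  ultimately have "0 < snd (billiard_map \<Omega> z) \<bullet> \<nu>"
    by (simp add: snd_billiard_map_flat[OF assms(3)] inner_diff_left)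
  then show ?thesis using assms(3) unfolding inward_def by blast
qed

text \<open>The image phase determines the incoming direction, because reflection is an involution, and then
  the starting point, because it is the last frontier point on the incoming ray.\<close>

lemma billiard_map_inj:
  assumes "compact \<Omega>" "inward \<Omega> z" "inward \<Omega> w"
    and "flat_at \<Omega> (fst (billiard_map \<Omega> z)) \<nu>"
    and eq: "billiard_map \<Omega> z = billiard_map \<Omega> w"
  shows "z = w"
proof -
  have n: "\<nu> \<bullet> \<nu> = 1" using assms(4) by (simp add: flat_at_def norm_eq_1)
  have refl: "snd u = snd (billiard_map \<Omega> u) - (2 * (snd (billiard_map \<Omega> u) \<bullet> \<nu>)) *\<^sub>R \<nu>"
    if "flat_at \<Omega> (fst (billiard_map \<Omega> u)) \<nu>" for u
    unfolding snd_billiard_map_flat[OF that] using n by (simp add: inner_diff_left algebra_simps)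
  have d: "snd z = snd w" using refl[of z] refl[of w] assms(4) eq by simp
  have p: "fst z + hit_time \<Omega> z *\<^sub>R snd z = fst w + hit_time \<Omega> w *\<^sub>R snd w"
    using eq by (metis fst_billiard_map)
  \<comment> \<open>Going backwards from the common end point, neither starting point can lie beyond the
    other, because the segment of the farther one would cross the frontier.\<close>
  have no: "\<not> hit_time \<Omega> u < hit_time \<Omega> u'"
    if "inward \<Omega> u" "inward \<Omega> u'" "snd u = snd u'"
      "fst u + hit_time \<Omega> u *\<^sub>R snd u = fst u' + hit_time \<Omega> u' *\<^sub>R snd u'" for u u'
  proof
    assume lt: "hit_time \<Omega> u < hit_time \<Omega> u'"
    have "fst u = fst u' + (hit_time \<Omega> u' - hit_time \<Omega> u) *\<^sub>R snd u'"
      using that(3,4) by (simp add: algebra_simps)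
    also have "\<dots> \<in> interior \<Omega>"
      using hit_time_first_exit[OF assms(1) that(2)] hit_time_first_exit(1)[OF assms(1) that(1)] lt
      by simp
    finally have "fst u \<in> interior \<Omega>" .
    moreover have "fst u \<in> frontier \<Omega>"
      using that(1) flat_at_frontier unfolding inward_def by blast
    ultimately show False by (simp add: frontier_def)
  qed
  have "hit_time \<Omega> z = hit_time \<Omega> w"
    using no[OF assms(2,3) d p] no[OF assms(3,2) d[symmetric] p[symmetric]] by simp
  then have "fst z = fst w" using p d by simp
  with d show ?thesis by (simp add: prod_eq_iff)
qed

section \<open>Regions composed of grid cells\<close>

definition grid :: "real \<Rightarrow> real set" where
  "grid s = range (\<lambda>k::int. s * of_int k)"

lemma gridE:
  assumes "a \<in> grid s"
  obtains k :: int where "a = s * of_int k"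
  using assms by (auto simp: grid_def)

lemma grid_of_int: "s * of_int k \<in> grid s"
  unfolding grid_def by (rule rangeI)

lemma grid_add: "a \<in> grid s \<Longrightarrow> b \<in> grid s \<Longrightarrow> a + b \<in> grid s"
  by (elim gridE) (simp only: distrib_left[symmetric] of_int_add[symmetric] grid_of_int)

lemma grid_minus: "a \<in> grid s \<Longrightarrow> - a \<in> grid s"
  by (elim gridE) (simp only: mult_minus_right[symmetric] of_int_minus[symmetric] grid_of_int)

lemma grid_diff: "a \<in> grid s \<Longrightarrow> b \<in> grid s \<Longrightarrow> a - b \<in> grid s"
  using grid_add[of a s "- b"] grid_minus[of b s] by simp

lemma grid_mult_int: "a \<in> grid s \<Longrightarrow> of_int k * a \<in> grid s"
  by (elim gridE) (simp only: mult.left_commute of_int_mult[symmetric] grid_of_int)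

lemma grid_half_superset: "grid s \<subseteq> grid (s / 2)"
proof
  fix a assume "a \<in> grid s"
  then obtain k :: int where "a = s * of_int k" by (auto simp: grid_def)
  then have "a = (s / 2) * of_int (2 * k)" by simp
  then show "a \<in> grid (s / 2)" unfolding grid_def by blast
qed

definition cell :: "real \<Rightarrow> int \<times> int \<Rightarrow> point set" where
  "cell s ij = {s * of_int (fst ij)..s * of_int (fst ij + 1)} \<times>
     {s * of_int (snd ij)..s * of_int (snd ij + 1)}"

definition grid_region :: "real \<Rightarrow> point set \<Rightarrow> bool" where
  "grid_region s \<Omega> \<longleftrightarrow> 0 < s \<and> compact \<Omega> \<and> (\<exists>C. \<Omega> = \<Union> (cell s ` C))"

text \<open>The bound \<open>r \<le> s\<close> ensures that an \<open>r\<close>-ball around a point of a vertical grid line meets only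
  the two columns of cells adjacent to that line.\<close>

lemma between_grid_lines:
  fixes a s :: real
  assumes "0 < s" "a \<notin> grid s"
  obtains j :: int and r where "r > 0" "r \<le> s"
    and "\<forall>b. \<bar>b - a\<bar> < r \<longrightarrow> s * of_int j < b \<and> b < s * of_int (j + 1)"
proof -
  define j where "j = \<lfloor>a / s\<rfloor>"
  have "of_int j \<le> a / s" "a / s < of_int j + 1"
    unfolding j_def by (auto simp: floor_correct)
  then have "s * of_int j \<le> a" "a < s * of_int (j + 1)"
    using assms(1) by (simp_all add: field_simps)
  moreover have "a \<noteq> s * of_int j" using assms(2) by (auto simp: grid_def)
  ultimately have ja: "s * of_int j < a" "a < s * of_int (j + 1)" by auto
  show thesis
    by (rule that[of "min s (min (a - s * of_int j) (s * of_int (j + 1) - a))" j])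
      (use ja assms(1) in auto)
qed

lemma cell_index_unique:
  fixes s b :: real and i j :: int
  assumes "0 < s" "s * of_int j < b" "b < s * of_int (j + 1)"
    and "s * of_int i \<le> b" "b \<le> s * of_int (i + 1)"
  shows "i = j"
proof -
  have "s * of_int j < s * of_int (i + 1)" "s * of_int i < s * of_int (j + 1)"
    using assms by linarith+
  then have "(of_int j :: real) < of_int (i + 1)" "(of_int i :: real) < of_int (j + 1)"
    using assms(1) by (simp_all only: mult_less_cancel_left_pos)
  then show ?thesis by linarith
qed

lemma abs_fst_snd_diff_ball:
  fixes p q :: point
  assumes "q \<in> ball p r"
  shows "\<bar>fst q - fst p\<bar> < r" "\<bar>snd q - snd p\<bar> < r"
  using assms dist_fst_le[of q p] dist_snd_le[of q p]
  by (auto simp: dist_commute dist_real_def)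

text \<open>Away from the horizontal grid lines only the cells to the left and to the right of \<open>p\<close> matter:
  \<open>A\<close> and \<open>B\<close> say whether they belong to the region. They are the same cell if \<open>p\<close> is not on a
  vertical grid line either.\<close>

lemma grid_region_local_fst:
  assumes s: "0 < s" and C: "\<Omega> = \<Union> (cell s ` C)" and y: "snd p \<notin> grid s"
  obtains A B r where "r > 0"
    and "\<forall>q \<in> ball p r. q \<in> \<Omega> \<longleftrightarrow> fst q \<le> fst p \<and> A \<or> fst p \<le> fst q \<and> B"
    and "fst p \<notin> grid s \<longrightarrow> A = B"
proof -
  obtain j r where r: "r > 0" "r \<le> s"
    and j: "\<forall>b. \<bar>b - snd p\<bar> < r \<longrightarrow> s * of_int j < b \<and> b < s * of_int (j + 1)"
    using between_grid_lines[OF s y] .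
  show thesis
  proof (cases "fst p \<in> grid s")
    case True
    then obtain k where k: "fst p = s * of_int k" by (auto simp: grid_def)
    show thesis
    proof (rule that[of r "(k - 1, j) \<in> C" "(k, j) \<in> C"]; (intro ballI)?)
      fix q assume "q \<in> ball p r"
      note b = abs_fst_snd_diff_ball[OF this]
      have q2: "s * of_int j < snd q" "snd q < s * of_int (j + 1)" using j b by auto
      have q1: "s * of_int (k - 1) < fst q" "fst q < s * of_int (k + 1)"
        using b r k by (auto simp: algebra_simps)
      have left: "q \<in> cell s (k - 1, j) \<longleftrightarrow> fst q \<le> fst p"
        and right: "q \<in> cell s (k, j) \<longleftrightarrow> fst p \<le> fst q"
        using q1 q2 k by (auto simp: cell_def mem_Times_iff)
      have "i = (k - 1, j) \<or> i = (k, j)" if "q \<in> cell s i" for i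
      proof -
        have "snd i = j"
          using that q2 s by (intro cell_index_unique[of s j "snd q"]) (auto simp: cell_def)
        moreover have "s * of_int (fst i) < s * of_int (k + 1)"
          "s * of_int (k - 1) < s * of_int (fst i + 1)"
          using that q1 by (auto simp: cell_def mem_Times_iff)
        then have "(of_int (fst i) :: real) < of_int (k + 1)"
          "(of_int (k - 1) :: real) < of_int (fst i + 1)"
          using s by (simp_all only: mult_less_cancel_left_pos)
        then have "fst i = k - 1 \<or> fst i = k" by linarith
        ultimately show ?thesis by (auto simp: prod_eq_iff)
      qed
      then have "q \<in> \<Omega> \<longleftrightarrow> q \<in> cell s (k - 1, j) \<and> (k - 1, j) \<in> C \<or> q \<in> cell s (k, j) \<and> (k, j) \<in> C"
        unfolding C by blast
      then show "q \<in> \<Omega> \<longleftrightarrow> fst q \<le> fst p \<and> (k - 1, j) \<in> C \<or> fst p \<le> fst q \<and> (k, j) \<in> C"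
        using left right by simp
    qed (use r True in auto)
  next
    case False
    obtain i r' where r': "r' > 0"
      and i: "\<forall>b. \<bar>b - fst p\<bar> < r' \<longrightarrow> s * of_int i < b \<and> b < s * of_int (i + 1)"
      using between_grid_lines[OF s False] .
    show thesis
    proof (rule that[of "min r r'" "(i, j) \<in> C" "(i, j) \<in> C"]; (intro ballI)?)
      fix q assume "q \<in> ball p (min r r')"
      note b = abs_fst_snd_diff_ball[OF this]
      have q2: "s * of_int j < snd q" "snd q < s * of_int (j + 1)" using j b by auto
      have q1: "s * of_int i < fst q" "fst q < s * of_int (i + 1)" using i b by auto
      have "q \<in> cell s (i, j)" using q1 q2 by (auto simp: cell_def mem_Times_iff)
      moreover have "ij = (i, j)" if "q \<in> cell s ij" for ij
      proof -
        have "snd ij = j" "fst ij = i"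
          using that q1 q2 s
            cell_index_unique[of s j "snd q" "snd ij"] cell_index_unique[of s i "fst q" "fst ij"]
          by (auto simp: cell_def mem_Times_iff)
        then show ?thesis by auto
      qed
      ultimately have "q \<in> \<Omega> \<longleftrightarrow> (i, j) \<in> C" unfolding C by blast
      then show "q \<in> \<Omega> \<longleftrightarrow> fst q \<le> fst p \<and> (i, j) \<in> C \<or> fst p \<le> fst q \<and> (i, j) \<in> C"
        by auto
    qed (use r r' in auto)
  qed
qed

lemma grid_region_local_snd:
  assumes s: "0 < s" and C: "\<Omega> = \<Union> (cell s ` C)" and x: "fst p \<notin> grid s"
  obtains A B r where "r > 0"
    and "\<forall>q \<in> ball p r. q \<in> \<Omega> \<longleftrightarrow> snd q \<le> snd p \<and> A \<or> snd p \<le> snd q \<and> B"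
    and "snd p \<notin> grid s \<longrightarrow> A = B"
proof -
  have cell_swap: "cell s (prod.swap i) = prod.swap ` cell s i" for i
    by (rule set_eqI, case_tac x) (simp add: cell_def conj_commute)
  have "prod.swap ` \<Omega> = \<Union> (cell s ` (prod.swap ` C))"
    unfolding C by (simp add: image_Union image_image cell_swap)
  moreover have "snd (prod.swap p) \<notin> grid s" using x by simp
  ultimately obtain A B r where r: "r > 0"
    and q: "\<forall>q \<in> ball (prod.swap p) r. q \<in> prod.swap ` \<Omega> \<longleftrightarrow>
      fst q \<le> fst (prod.swap p) \<and> A \<or> fst (prod.swap p) \<le> fst q \<and> B"
    and AB: "fst (prod.swap p) \<notin> grid s \<longrightarrow> A = B"
    by (rule grid_region_local_fst[OF s])
  show thesis
  proof (rule that[OF r]; (intro ballI)?)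
    fix q' assume "q' \<in> ball p r"
    then have "prod.swap q' \<in> ball (prod.swap p) r"
      by (simp add: dist_prod_def add.commute)
    then show "q' \<in> \<Omega> \<longleftrightarrow> snd q' \<le> snd p \<and> A \<or> snd p \<le> snd q' \<and> B"
      using q[rule_format, of "prod.swap q'"] by (simp add: inj_image_mem_iff[OF inj_swap])
  qed (use AB in simp)
qed

text \<open>Vertices of a union of cells are grid points. At any other frontier point the local picture
  is given by two adjacent cells, of which exactly one belongs to the region: with none or both of
  them the point would be exterior or interior.\<close>

lemma grid_region_flat:
  assumes "grid_region s \<Omega>" "p \<in> frontier \<Omega>" and nv: "\<not> (fst p \<in> grid s \<and> snd p \<in> grid s)"
  obtains \<nu> where "flat_at \<Omega> p \<nu>"
    and "fst p \<in> grid s \<and> \<nu> \<in> {(1, 0), (- 1, 0)} \<or> snd p \<in> grid s \<and> \<nu> \<in> {(0, 1), (0, - 1)}"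
proof -
  from assms(1) obtain C where s: "0 < s" and C: "\<Omega> = \<Union> (cell s ` C)"
    by (auto simp: grid_region_def)
  have mixed: "\<not> (\<forall>q \<in> ball p r. q \<in> \<Omega>)" "\<not> (\<forall>q \<in> ball p r. q \<notin> \<Omega>)" if "r > 0" for r
  proof -
    have "p \<in> closure \<Omega>" "p \<notin> interior \<Omega>" using assms(2) by (auto simp: frontier_def)
    then show "\<not> (\<forall>q \<in> ball p r. q \<in> \<Omega>)" "\<not> (\<forall>q \<in> ball p r. q \<notin> \<Omega>)"
      using that by (force simp: mem_interior closure_approachable dist_commute subset_iff)+
  qed
  show thesis
  proof (cases "snd p \<in> grid s")
    case False
    obtain A B r where r: "r > 0"
      and q: "\<forall>q \<in> ball p r. q \<in> \<Omega> \<longleftrightarrow> fst q \<le> fst p \<and> A \<or> fst p \<le> fst q \<and> B"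
      and AB: "fst p \<notin> grid s \<longrightarrow> A = B"
      by (rule grid_region_local_fst[OF s C False])
    have ne: "A \<noteq> B" using mixed[OF r] q linear by blast
    with AB have g: "fst p \<in> grid s" by blast
    define \<nu> :: point where "\<nu> = (if B then (1, 0) else (- 1, 0))"
    have "\<Omega> \<inter> ball p r = {y \<in> ball p r. 0 \<le> (y - p) \<bullet> \<nu>}"
      using q ne by (auto simp: \<nu>_def inner_prod_def)
    then have "flat_at \<Omega> p \<nu>" using r by (auto simp: flat_at_def \<nu>_def norm_prod_def)
    then show thesis using that g by (auto simp: \<nu>_def split: if_splits)
  next
    case True
    then have "fst p \<notin> grid s" using nv by blast
    then obtain A B r where r: "r > 0"
      and q: "\<forall>q \<in> ball p r. q \<in> \<Omega> \<longleftrightarrow> snd q \<le> snd p \<and> A \<or> snd p \<le> snd q \<and> B"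
      and "snd p \<notin> grid s \<longrightarrow> A = B"
      by (rule grid_region_local_snd[OF s C])
    have ne: "A \<noteq> B" using mixed[OF r] q linear by blast
    define \<nu> :: point where "\<nu> = (if B then (0, 1) else (0, - 1))"
    have "\<Omega> \<inter> ball p r = {y \<in> ball p r. 0 \<le> (y - p) \<bullet> \<nu>}"
      using q ne by (auto simp: \<nu>_def inner_prod_def)
    then have "flat_at \<Omega> p \<nu>" using r by (auto simp: flat_at_def \<nu>_def norm_prod_def)
    then show thesis using that True by (auto simp: \<nu>_def split: if_splits)
  qed
qed

lemma grid_region_Un:
  assumes "grid_region s \<Omega>" "grid_region s \<Omega>'"
  shows "grid_region s (\<Omega> \<union> \<Omega>')"
proof -
  obtain C C' where "\<Omega> = \<Union> (cell s ` C)" "\<Omega>' = \<Union> (cell s ` C')"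
    using assms unfolding grid_region_def by blast
  then have "\<Omega> \<union> \<Omega>' = \<Union> (cell s ` (C \<union> C'))" by blast
  then show ?thesis using assms compact_Un unfolding grid_region_def by blast
qed

lemma grid_region_UN:
  assumes "finite I" "0 < s" "\<And>i. i \<in> I \<Longrightarrow> grid_region s (\<Omega> i)"
  shows "grid_region s (\<Union>i\<in>I. \<Omega> i)"
  using assms
proof (induction I rule: finite_induct)
  case empty
  then show ?case by (auto simp: grid_region_def intro: exI[of _ "{}"])
qed (auto intro: grid_region_Un)

lemma grid_interval_cover:
  fixes s x :: real and i i' :: int
  assumes "0 < s" "i < i'" "s * of_int i \<le> x" "x \<le> s * of_int i'"
  obtains k where "i \<le> k" "k < i'" "s * of_int k \<le> x" "x \<le> s * of_int (k + 1)"
proof -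
  define k where "k = min \<lfloor>x / s\<rfloor> (i' - 1)"
  have 1: "of_int i \<le> x / s" "x / s \<le> of_int i'" using assms by (simp_all add: field_simps)
  have "of_int k \<le> x / s" "x / s \<le> of_int (k + 1)"
    using 1 by (auto simp: k_def min_def) linarith+
  then have "s * of_int k \<le> x" "x \<le> s * of_int (k + 1)"
    using assms(1) by (simp_all add: field_simps)
  moreover have "i \<le> k" "k < i'" using 1 assms(2) by (auto simp: k_def le_floor_iff)
  ultimately show thesis using that by blast
qed

lemma rectangle_eq_Union_cells:
  fixes s :: real and i i' j j' :: int
  assumes "0 < s" "i < i'" "j < j'"
  shows "{s * of_int i..s * of_int i'} \<times> {s * of_int j..s * of_int j'} =
    \<Union> (cell s ` ({i..<i'} \<times> {j..<j'}))" (is "?L = ?R")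
proof (intro equalityI subsetI)
  fix p assume "p \<in> ?L"
  then have 1: "s * of_int i \<le> fst p" "fst p \<le> s * of_int i'"
    and 2: "s * of_int j \<le> snd p" "snd p \<le> s * of_int j'" by (auto simp: mem_Times_iff)
  obtain k where k: "i \<le> k" "k < i'" "s * of_int k \<le> fst p" "fst p \<le> s * of_int (k + 1)"
    using grid_interval_cover[OF assms(1,2) 1] .
  obtain l where l: "j \<le> l" "l < j'" "s * of_int l \<le> snd p" "snd p \<le> s * of_int (l + 1)"
    using grid_interval_cover[OF assms(1,3) 2] .
  have "p \<in> cell s (k, l)" using k l by (auto simp: cell_def mem_Times_iff)
  moreover have "(k, l) \<in> {i..<i'} \<times> {j..<j'}" using k l by simp
  ultimately show "p \<in> ?R" by blast
next
  fix p assume "p \<in> ?R"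
  then obtain k l where kl: "i \<le> k" "k < i'" "j \<le> l" "l < j'" and p: "p \<in> cell s (k, l)" by auto
  have "s * of_int i \<le> s * of_int k" "s * of_int (k + 1) \<le> s * of_int i'"
    "s * of_int j \<le> s * of_int l" "s * of_int (l + 1) \<le> s * of_int j'"
    using assms(1) kl by (intro mult_left_mono; simp)+
  then show "p \<in> ?L" using p by (auto simp: cell_def mem_Times_iff)
qed

lemma grid_region_rectangle:
  assumes s: "0 < s" and g: "a \<in> grid s" "a' \<in> grid s" "b \<in> grid s" "b' \<in> grid s"
    and lt: "a < a'" "b < b'"
  shows "grid_region s ({a..a'} \<times> {b..b'})"
proof -
  obtain i i' j j' :: int where e: "a = s * of_int i" "a' = s * of_int i'"
    "b = s * of_int j" "b' = s * of_int j'"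
    using g unfolding grid_def by blast
  have "i < i'" "j < j'" using lt s unfolding e by (simp_all)
  from rectangle_eq_Union_cells[OF s this] show ?thesis
    unfolding grid_region_def e using s compact_Times[OF compact_Icc compact_Icc] by blast
qed

lemma grid_region_half:
  assumes "grid_region s \<Omega>"
  shows "grid_region (s / 2) \<Omega>"
proof -
  obtain C where C: "\<Omega> = \<Union> (cell s ` C)" and s: "0 < s" and k: "compact \<Omega>"
    using assms by (auto simp: grid_region_def)
  define D where "D ij = {2 * fst ij..<2 * fst ij + 2} \<times> {2 * snd ij..<2 * snd ij + 2}" for ij :: "int \<times> int"
  have "cell s ij = \<Union> (cell (s / 2) ` D ij)" for ij
    unfolding D_def using s
    by (subst rectangle_eq_Union_cells[symmetric]) (auto simp: cell_def algebra_simps)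
  then have "\<Omega> = \<Union> (cell (s / 2) ` (\<Union> (D ` C)))" unfolding C by auto
  moreover have "0 < s / 2" using s by simp
  ultimately show ?thesis using k unfolding grid_region_def by blast
qed

lemma grid_region_unit_square:
  assumes "fst c \<in> \<int>" "snd c \<in> \<int>"
  shows "grid_region 1 (unit_square c)"
proof -
  have "a \<in> grid 1" if "a \<in> \<int>" for a using that by (auto simp: grid_def elim: Ints_cases)
  then show ?thesis unfolding unit_square_def using assms
    by (intro grid_region_rectangle) auto
qed

lemma grid_region_T_shape:
  assumes "0 < s" "fst p \<in> grid s" "snd p \<in> grid s"
  shows "grid_region s (T_shape s p)"
proof -
  note m = grid_of_int[of s]
  have "2 * s \<in> grid s" "3 * s \<in> grid s" "s \<in> grid s"
    using m[of 2] m[of 3] m[of 1] by (simp_all add: mult.commute)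
  then show ?thesis using assms unfolding T_shape_def
    by (cases p) (auto intro!: grid_region_Un grid_region_rectangle grid_add grid_diff)
qed

text \<open>The next bases are offset from the old ones by multiples of the old scale, so they lie
  even in the coarser grid of the stage before.\<close>

lemma T_bases_grid:
  "finite (T_bases n) \<and> (\<forall>p \<in> T_bases n. fst p \<in> grid (1 / 2 ^ n) \<and> snd p \<in> grid (1 / 2 ^ n))"
proof (induction n)
  case 0
  then show ?case by (auto simp: grid_def image_iff)
next
  case (Suc n)
  define s :: real where "s = 1 / 2 ^ n"
  have half: "1 / 2 ^ Suc n = s / 2" by (simp add: s_def)
  note m = grid_of_int[of s]
  have "2 * s \<in> grid s" "3 * s \<in> grid s" "s \<in> grid s"
    using m[of 2] m[of 3] m[of 1] by (simp_all add: mult.commute)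
  then have "fst p \<in> grid s \<and> snd p \<in> grid s" if "p \<in> T_bases (Suc n)" for p
    using that Suc by (auto simp: Let_def s_def[symmetric] intro!: grid_add grid_diff)
  then show ?case unfolding half using grid_half_superset[of s] Suc
    by (auto simp: Let_def)
qed

lemma grid_region_T_region: "grid_region (1 / 2 ^ n) (T_region n)"
proof (induction n)
  case 0
  have "0 \<in> grid 1" by (simp add: grid_def image_iff)
  then show ?case using grid_region_T_shape[of 1 "(0, 0)"] by simp
next
  case (Suc n)
  have "grid_region (1 / 2 ^ Suc n) (T_region n)"
    using grid_region_half[OF Suc] by (simp add: mult.commute)
  moreover have "grid_region (1 / 2 ^ Suc n) (\<Union>p\<in>T_bases (Suc n). T_shape (1 / 2 ^ Suc n) p)"
    using T_bases_grid[of "Suc n"] by (intro grid_region_UN grid_region_T_shape) auto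
  ultimately show ?case by (simp only: T_region.simps grid_region_Un)
qed

section \<open>Unfolding orbits to straight lines\<close>

text \<open>One coordinate of an unfolded motion, with position \<open>r\<close> and velocity \<open>d\<close>, against the same
  coordinate \<open>r'\<close>, \<open>d'\<close> of the motion in the region. Reflections in lines of the grid generate shifts
  by \<open>2 s\<close> only, but shifts by \<open>s\<close> are enough to compare membership in the grid.\<close>

definition folded :: "real \<Rightarrow> real \<Rightarrow> real \<Rightarrow> real \<Rightarrow> real \<Rightarrow> bool" where
  "folded s r d r' d' \<longleftrightarrow>
     (\<exists>e b. (e = 1 \<or> e = - 1) \<and> b \<in> grid s \<and> r' = e * r + b \<and> d' = e * d)"

lemma folded_refl: "folded s r d r d"
  unfolding folded_def using grid_of_int[of s 0] by (intro exI[of _ 1] exI[of _ 0]) simp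

lemma folded_shift:
  assumes "folded s r d r' d'"
  shows "folded s (r + t * d) d (r' + t * d') d'"
  using assms by (auto simp: folded_def algebra_simps)

lemma folded_grid_iff:
  assumes "folded s r d r' d'"
  shows "r' \<in> grid s \<longleftrightarrow> r \<in> grid s"
proof -
  obtain e b where e: "e = 1 \<or> e = - 1" and b: "b \<in> grid s" and r: "r' = e * r + b"
    using assms by (auto simp: folded_def)
  have "r = e * (r' - b)" using e r by auto
  then show ?thesis
    using e b r grid_add[of _ s b] grid_diff[of _ s b] grid_minus[of _ s] by (metis mult_1 mult_minus1)
qed

text \<open>A reflection in the grid line through \<open>r'\<close> replaces \<open>e * r + b\<close> by \<open>- e * r + (2 r' - b)\<close>.\<close>

lemma folded_reflect:
  assumes "folded s r d r' d'" "r' \<in> grid s"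
  shows "folded s r d r' (- d')"
proof -
  obtain e b where e: "e = 1 \<or> e = - 1" and b: "b \<in> grid s" and r: "r' = e * r + b"
    and d: "d' = e * d"
    using assms(1) by (auto simp: folded_def)
  have "(r' + r') - b \<in> grid s" using assms(2) b by (intro grid_diff grid_add)
  moreover have "r' = (- e) * r + ((r' + r') - b)" "- d' = (- e) * d" using r d by simp_all
  moreover have "- e = 1 \<or> - e = - 1" using e by auto
  ultimately show ?thesis unfolding folded_def by blast
qed

text \<open>Over a period of the folded motion the unfolded one advances by a grid multiple. The
  orientation \<open>e = - 1\<close> is possible only if the coordinate does not move at all.\<close>

lemma folded_return:
  assumes "folded s (r + t * d) d r d"
  shows "t * d \<in> grid s"
proof -
  obtain e b where e: "e = 1 \<or> e = - 1" and b: "b \<in> grid s" and r: "r = e * (r + t * d) + b"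
    and d: "d = e * d"
    using assms by (auto simp: folded_def)
  from e show ?thesis
  proof
    assume "e = 1"
    then have "t * d = - b" using r by simp
    then show ?thesis using grid_minus[OF b] by simp
  next
    assume "e = - 1"
    then have "d = 0" using d by simp
    then show ?thesis using grid_of_int[of s 0] by simp
  qed
qed

text \<open>The phase \<open>w\<close> is a folded image of the phase reached from \<open>z\<close> by moving straight for time \<open>t\<close>.\<close>

definition unfolds_to :: "real \<Rightarrow> phase \<Rightarrow> real \<Rightarrow> phase \<Rightarrow> bool" where
  "unfolds_to s z t w \<longleftrightarrow>
     folded s (fst (fst z) + t * fst (snd z)) (fst (snd z)) (fst (fst w)) (fst (snd w)) \<and>
     folded s (snd (fst z) + t * snd (snd z)) (snd (snd z)) (snd (fst w)) (snd (snd w))"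

lemma unfolds_to_shift:
  assumes "unfolds_to s z t w"
  shows "unfolds_to s z (t + \<tau>) (fst w + \<tau> *\<^sub>R snd w, snd w)"
  using assms folded_shift[of s _ _ _ _ \<tau>] by (fastforce simp: unfolds_to_def algebra_simps)

text \<open>Off the vertices the side that is hit lies on a grid line, with an axis-parallel normal. So the
  reflection only reverses the velocity of the one coordinate whose value is in the grid.\<close>

lemma unfolds_to_billiard_map:
  assumes g: "grid_region s \<Omega>" and i: "inward \<Omega> w" and u: "unfolds_to s z t w"
    and nv: "fst (billiard_map \<Omega> w) \<notin> grid s \<times> grid s"
  shows "inward \<Omega> (billiard_map \<Omega> w) \<and> unfolds_to s z (t + hit_time \<Omega> w) (billiard_map \<Omega> w)"
proof -
  have c: "compact \<Omega>" using g by (simp add: grid_region_def)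
  define y where "y = fst (billiard_map \<Omega> w)"
  have y: "y = fst w + hit_time \<Omega> w *\<^sub>R snd w" by (simp add: y_def fst_billiard_map)
  have "y \<in> frontier \<Omega>" unfolding y by (rule hit_time_first_exit[OF c i])
  moreover have "\<not> (fst y \<in> grid s \<and> snd y \<in> grid s)" using nv by (simp add: y_def mem_Times_iff)
  ultimately obtain \<nu> where fl: "flat_at \<Omega> y \<nu>"
    and nu: "fst y \<in> grid s \<and> \<nu> \<in> {(1, 0), (- 1, 0)} \<or> snd y \<in> grid s \<and> \<nu> \<in> {(0, 1), (0, - 1)}"
    by (rule grid_region_flat[OF g])
  note fl' = fl[unfolded y_def]
  have sh: "unfolds_to s z (t + hit_time \<Omega> w) (y, snd w)"
    using unfolds_to_shift[OF u] by (simp add: y)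
  have "billiard_map \<Omega> w = (y, snd w - (2 * (snd w \<bullet> \<nu>)) *\<^sub>R \<nu>)"
    using snd_billiard_map_flat[OF fl'] by (simp add: y_def prod_eq_iff)
  then have bm: "fst y \<in> grid s \<and> billiard_map \<Omega> w = (y, (- fst (snd w), snd (snd w))) \<or>
    snd y \<in> grid s \<and> billiard_map \<Omega> w = (y, (fst (snd w), - snd (snd w)))"
    using nu by (auto simp: inner_prod_def prod_eq_iff)
  have "unfolds_to s z (t + hit_time \<Omega> w) (billiard_map \<Omega> w)"
    using bm sh folded_reflect by (auto simp: unfolds_to_def)
  then show ?thesis using inward_billiard_map[OF c i fl'] by blast
qed

lemma inward_initial_condition:
  assumes "grid_region s \<Omega>" "initial_condition \<Omega> z" "fst z \<notin> grid s \<times> grid s"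
  shows "inward \<Omega> z"
proof -
  have "fst z \<in> frontier \<Omega>" "\<not> (fst (fst z) \<in> grid s \<and> snd (fst z) \<in> grid s)"
    using assms(2,3) by (simp_all add: initial_condition_def mem_Times_iff)
  then obtain \<nu> where "flat_at \<Omega> (fst z) \<nu>" by (rule grid_region_flat[OF assms(1)])
  then show ?thesis
    using assms(2) flat_at_ray_in_interior_iff unfolding initial_condition_def inward_def by blast
qed

definition elapsed_time :: "point set \<Rightarrow> phase \<Rightarrow> nat \<Rightarrow> real" where
  "elapsed_time \<Omega> z k = (\<Sum>j<k. hit_time \<Omega> (billiard_orbit \<Omega> z j))"

lemma billiard_orbit_Suc: "billiard_orbit \<Omega> z (Suc k) = billiard_map \<Omega> (billiard_orbit \<Omega> z k)"
  by (simp add: billiard_orbit_def)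

text \<open>The hypothesis that vertices are avoided may use that the orbit has unfolded so far: for the
  prefractals it follows from the line, whereas for the square it is known from the footprint.\<close>

lemma billiard_orbit_unfolds:
  assumes g: "grid_region s \<Omega>" and i: "inward \<Omega> z"
    and nv: "\<And>k. unfolds_to s z (elapsed_time \<Omega> z k) (billiard_orbit \<Omega> z k) \<Longrightarrow>
      inward \<Omega> (billiard_orbit \<Omega> z k) \<Longrightarrow> fst (billiard_orbit \<Omega> z (Suc k)) \<notin> grid s \<times> grid s"
  shows "inward \<Omega> (billiard_orbit \<Omega> z k) \<and>
    unfolds_to s z (elapsed_time \<Omega> z k) (billiard_orbit \<Omega> z k)"
proof (induction k)
  case 0
  then show ?case using i
    by (simp add: billiard_orbit_def elapsed_time_def unfolds_to_def folded_refl)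
next
  case (Suc k)
  have "elapsed_time \<Omega> z (Suc k) = elapsed_time \<Omega> z k + hit_time \<Omega> (billiard_orbit \<Omega> z k)"
    by (simp add: elapsed_time_def)
  then show ?case
    using unfolds_to_billiard_map[OF g, of "billiard_orbit \<Omega> z k" z "elapsed_time \<Omega> z k"] Suc nv[of k]
    by (simp add: billiard_orbit_Suc)
qed

section \<open>Lines of rational slope that avoid the grid\<close>

lemma injective_orbit_in_finite_set_returns:
  assumes "finite S" "\<And>k. (f ^^ k) z \<in> S"
    and "\<And>i j. f ((f ^^ i) z) = f ((f ^^ j) z) \<Longrightarrow> (f ^^ i) z = (f ^^ j) z"
  shows "\<exists>m\<ge>1. (f ^^ m) z = z"
proof -
  have "finite (range (\<lambda>k. (f ^^ k) z))"
    using assms(1,2) by (blast intro: finite_subset)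
  then have "\<not> inj (\<lambda>k. (f ^^ k) z)" using finite_imageD infinite_UNIV_nat by blast
  then obtain i j where "i < j" "(f ^^ i) z = (f ^^ j) z"
    unfolding inj_def by (metis linorder_neqE_nat)
  then obtain m where m: "m \<ge> 1" "(f ^^ i) z = (f ^^ (i + m)) z"
    by (metis less_imp_add_positive One_nat_def Suc_leI)
  have "(f ^^ n) z = (f ^^ (n + m)) z \<Longrightarrow> z = (f ^^ m) z" for n
    by (induction n) (use assms(3) in auto)
  then show ?thesis using m by metis
qed

text \<open>This bounds the possible values of one coordinate of a boundary point on the orbit, once the other
  coordinate is in the grid and the linear form \<open>Q x - P y\<close> is known up to sign and grid multiples.\<close>

lemma finite_bounded_affine_grid:
  fixes c e R s :: real
  assumes "c \<noteq> 0" "0 < s"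
  shows "finite {a. \<bar>a\<bar> \<le> R \<and> c * a - e \<in> grid s}"
proof -
  define N where "N = \<lceil>(\<bar>c\<bar> * R + \<bar>e\<bar>) / s\<rceil>"
  have "{a. \<bar>a\<bar> \<le> R \<and> c * a - e \<in> grid s} \<subseteq> (\<lambda>k. (s * of_int k + e) / c) ` {- N..N}"
  proof
    fix a assume a: "a \<in> {a. \<bar>a\<bar> \<le> R \<and> c * a - e \<in> grid s}"
    then obtain k :: int where k: "c * a - e = s * of_int k" by (auto elim: gridE)
    have "\<bar>s * of_int k\<bar> \<le> \<bar>c * a\<bar> + \<bar>e\<bar>" unfolding k[symmetric] by linarith
    also have "\<dots> \<le> \<bar>c\<bar> * R + \<bar>e\<bar>" using a by (simp add: abs_mult mult_left_mono)
    finally have "\<bar>of_int k\<bar> * s \<le> \<bar>c\<bar> * R + \<bar>e\<bar>" using assms(2) by (simp add: abs_mult mult.commute)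
    then have "\<bar>of_int k\<bar> \<le> (\<bar>c\<bar> * R + \<bar>e\<bar>) / s" using assms(2) by (simp add: pos_le_divide_eq)
    also have "\<dots> \<le> of_int N" unfolding N_def by (rule le_of_int_ceiling)
    finally have "\<bar>k\<bar> \<le> N" by linarith
    then have "k \<in> {- N..N}" by auto
    moreover have "a = (s * of_int k + e) / c" using k assms(1) by (simp add: field_simps)
    ultimately show "a \<in> (\<lambda>k. (s * of_int k + e) / c) ` {- N..N}" by (rule rev_image_eqI)
  qed
  then show ?thesis by (rule finite_subset) simp
qed

text \<open>The form \<open>J = Q x - P y\<close> is constant on the unfolded line. If the line met a grid point, \<open>J\<close>
  would be in the grid; so no vertex is ever hit. A boundary point of the orbit has one coordinate in
  the bounded grid, and folding \<open>J\<close> leaves finitely many values for the other. Hence the orbit stays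
  in a finite set on which the billiard map is injective.\<close>

lemma periodic_orbit_rational_line:
  fixes P Q :: int and l s x y :: real
  defines "z \<equiv> ((x, y), l *\<^sub>R (of_int P, of_int Q))"
  assumes g: "grid_region s \<Omega>" and ic: "initial_condition \<Omega> z"
    and off: "of_int Q * x - of_int P * y \<notin> grid s"
  shows "periodic_orbit \<Omega> z"
proof -
  define J where "J = of_int Q * x - of_int P * y"
  define u v where "u = l * of_int P" and "v = l * of_int Q"
  have z: "z = ((x, y), (u, v))" by (simp add: z_def u_def v_def)
  have c: "compact \<Omega>" and s: "0 < s" using g by (auto simp: grid_region_def)
  have J_line: "of_int Q * (x + t * u) - of_int P * (y + t * v) = J" for t
    by (simp add: J_def u_def v_def algebra_simps)
  have line: "\<not> (x + t * u \<in> grid s \<and> y + t * v \<in> grid s)" for t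
    using J_line[of t] off grid_diff grid_mult_int unfolding J_def by metis
  have nv: "fst w \<notin> grid s \<times> grid s" if "unfolds_to s z t w" for t w
    using that line[of t] by (auto simp: unfolds_to_def z folded_grid_iff mem_Times_iff)
  have "inward \<Omega> z"
    using inward_initial_condition[OF g ic] line[of 0] by (simp add: z)
  then have orbit: "inward \<Omega> (billiard_orbit \<Omega> z k)"
    "unfolds_to s z (elapsed_time \<Omega> z k) (billiard_orbit \<Omega> z k)" for k
    using billiard_orbit_unfolds[OF g, of z k] nv[OF unfolds_to_shift]
    by (auto simp: billiard_orbit_Suc fst_billiard_map)
  have flat: "\<exists>\<nu>. flat_at \<Omega> (fst (billiard_orbit \<Omega> z k)) \<nu>" for k
    using orbit(1)[of k] by (auto simp: inward_def simp del: split_paired_Ex)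
  obtain R where R: "\<And>p. p \<in> \<Omega> \<Longrightarrow> norm p \<le> R"
    using compact_imp_bounded[OF c] unfolding bounded_iff by blast
  \<comment> \<open>The case \<open>c = 0\<close> is excluded to keep \<open>F c e\<close> finite. It does not occur: if one of \<open>P\<close> and
    \<open>Q\<close> vanishes, the coordinate that stays constant along the line is not in the grid.\<close>
  define F where "F c e = (if c = 0 then {} else {a. \<bar>a\<bar> \<le> R \<and> c * a - e \<in> grid s})" for c e :: real
  have fin: "finite (F c e)" for c e using finite_bounded_affine_grid[OF _ s] by (simp add: F_def)
  define A where "A = F 1 0 \<union> F (of_int P) J \<union> F (of_int P) (- J) \<union> F (of_int Q) J \<union> F (of_int Q) (- J)"
  define S where "S = (A \<times> A) \<times> ({u, - u} \<times> {v, - v})"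
  have "finite S" using fin by (simp add: S_def A_def)
  moreover have in_S: "billiard_orbit \<Omega> z k \<in> S" for k
  proof -
    obtain p d where w: "billiard_orbit \<Omega> z k = (p, d)" by (metis prod.collapse)
    have p_fr: "p \<in> frontier \<Omega>" using flat[of k] flat_at_frontier unfolding w fst_conv by blast
    then have "p \<in> \<Omega>" using compact_imp_closed[OF c] frontier_subset_eq by blast
    then have bd: "\<bar>fst p\<bar> \<le> R" "\<bar>snd p\<bar> \<le> R"
      using R[of p] norm_fst_le[of "fst p" "snd p"] norm_snd_le[of "snd p" "fst p"] by auto
    define t where "t = elapsed_time \<Omega> z k"
    have unf: "unfolds_to s z t (p, d)" using orbit(2)[of k] w by (simp add: t_def)
    then obtain e1 b1 e2 b2 where e1: "e1 = 1 \<or> e1 = - 1" and b1: "b1 \<in> grid s"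
      and p1: "fst p = e1 * (x + t * u) + b1" and d1: "fst d = e1 * u"
      and e2: "e2 = 1 \<or> e2 = - 1" and b2: "b2 \<in> grid s"
      and p2: "snd p = e2 * (y + t * v) + b2" and d2: "snd d = e2 * v"
      by (auto simp: unfolds_to_def folded_def z)
    have l1: "x + t * u = e1 * (fst p - b1)" using p1 e1 by auto
    have l2: "y + t * v = e2 * (snd p - b2)" using p2 e2 by auto
    have J: "of_int Q * (e1 * (fst p - b1)) - of_int P * (e2 * (snd p - b2)) = J"
      using J_line[of t] unfolding l1 l2 .
    have e_grid: "e1 * a \<in> grid s" "e2 * a \<in> grid s" if "a \<in> grid s" for a
      using that e1 e2 grid_minus by auto
    have "\<not> (fst p \<in> grid s \<and> snd p \<in> grid s)"
      using nv[OF unf] by (simp add: mem_Times_iff)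
    then have "fst p \<in> grid s \<or> snd p \<in> grid s"
      using grid_region_flat[OF g p_fr] by blast
    then have "fst p \<in> A \<and> snd p \<in> A"
    proof
      assume h: "fst p \<in> grid s"
      then have h1: "fst p \<in> F 1 0" using bd by (simp add: F_def)
      have g1: "of_int Q * (e1 * (fst p - b1)) \<in> grid s"
        by (intro grid_mult_int e_grid grid_diff h b1)
      have P0: "P \<noteq> 0" using g1 J off by (auto simp: J_def)
      have "of_int P * snd p - (- (e2 * J)) =
        e2 * (of_int Q * (e1 * (fst p - b1))) + of_int P * b2"
        using e2 unfolding J[symmetric] by (auto simp: algebra_simps)
      also have "\<dots> \<in> grid s" by (intro grid_add e_grid g1 grid_mult_int b2)
      finally have "snd p \<in> F (of_int P) J \<union> F (of_int P) (- J)"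
        using e2 P0 bd by (auto simp: F_def)
      then show ?thesis using h1 by (auto simp: A_def)
    next
      assume h: "snd p \<in> grid s"
      then have h1: "snd p \<in> F 1 0" using bd by (simp add: F_def)
      have g1: "of_int P * (e2 * (snd p - b2)) \<in> grid s"
        by (intro grid_mult_int e_grid grid_diff h b2)
      have Q0: "Q \<noteq> 0" using grid_minus[OF g1] J off by (auto simp: J_def)
      have "of_int Q * fst p - e1 * J =
        e1 * (of_int P * (e2 * (snd p - b2))) + of_int Q * b1"
        using e1 unfolding J[symmetric] by (auto simp: algebra_simps)
      also have "\<dots> \<in> grid s" by (intro grid_add e_grid g1 grid_mult_int b1)
      finally have "fst p \<in> F (of_int Q) J \<union> F (of_int Q) (- J)"
        using e1 Q0 bd by (auto simp: F_def)
      then show ?thesis using h1 by (auto simp: A_def)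
    qed
    moreover have "fst d \<in> {u, - u}" "snd d \<in> {v, - v}" using e1 e2 d1 d2 by auto
    ultimately show ?thesis unfolding w S_def mem_Times_iff fst_conv snd_conv by blast
  qed
  moreover have "billiard_orbit \<Omega> z i = billiard_orbit \<Omega> z j"
    if eq: "billiard_map \<Omega> (billiard_orbit \<Omega> z i) = billiard_map \<Omega> (billiard_orbit \<Omega> z j)" for i j
  proof -
    obtain \<nu> where "flat_at \<Omega> (fst (billiard_map \<Omega> (billiard_orbit \<Omega> z i))) \<nu>"
      using flat[of "Suc i"] unfolding billiard_orbit_Suc by blast
    from billiard_map_inj[OF c orbit(1) orbit(1) this eq] show ?thesis .
  qed
  ultimately have "\<exists>m\<ge>1. billiard_orbit \<Omega> z m = z"
    unfolding billiard_orbit_def by (intro injective_orbit_in_finite_set_returns[of S]) auto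
  then show ?thesis using flat unfolding periodic_orbit_def reflection_defined_def by blast
qed

section \<open>Periodic orbits of the unit square\<close>

lemma dyadic_rational_iff_grid: "dyadic_rational a \<longleftrightarrow> (\<exists>n. a \<in> grid (1 / 2 ^ n))"
  by (auto simp: dyadic_rational_def grid_def image_iff)

lemma grid_one_subset: "grid 1 \<subseteq> grid (1 / 2 ^ n)"
proof
  fix a assume "a \<in> grid 1"
  then obtain k :: int where "a = 1 * of_int k" by (rule gridE)
  then have "a = (1 / 2 ^ n) * of_int (2 ^ n * k)" by simp
  then show "a \<in> grid (1 / 2 ^ n)" by (simp only: grid_of_int)
qed

lemma dyadic_rational_diff_int:
  assumes "dyadic_rational a" "b \<in> grid 1"
  shows "dyadic_rational (a - b)"
  using assms grid_one_subset grid_diff unfolding dyadic_rational_iff_grid by blast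

lemma dyadic_rational_folded:
  assumes "folded 1 r d r' d'" "dyadic_rational r"
  shows "dyadic_rational r'"
proof -
  obtain e b where "e = 1 \<or> e = - 1" "b \<in> grid 1" "r' = e * r + b"
    using assms(1) by (auto simp: folded_def)
  moreover obtain n where "r \<in> grid (1 / 2 ^ n)" using assms(2) by (auto simp: dyadic_rational_iff_grid)
  ultimately have "r' \<in> grid (1 / 2 ^ n)"
    using grid_minus grid_one_subset by (auto intro!: grid_add grid_diff)
  then show ?thesis by (auto simp: dyadic_rational_iff_grid)
qed

text \<open>Write \<open>J = m / 2 ^ n\<close> and let \<open>P'\<close> be the odd part of \<open>P\<close>. As \<open>2 ^ n * Q\<close> is invertible modulo
  \<open>P'\<close>, some \<open>k\<close> makes \<open>P'\<close> divide \<open>2 ^ n * Q * k - m\<close>; the remaining denominator is a power of two.\<close>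

lemma coprime_line_dyadic_point:
  fixes P Q :: int
  assumes "coprime P Q" "P \<noteq> 0" "dyadic_rational J"
  obtains k :: int where "dyadic_rational ((of_int Q * of_int k - J) / of_int P)"
proof -
  obtain m :: int and n :: nat where J: "J = of_int m / 2 ^ n"
    using assms(3) by (auto simp: dyadic_rational_def)
  obtain P' where P': "P = 2 ^ multiplicity 2 P * P'" "\<not> 2 dvd P'"
    using multiplicity_decompose'[of P 2] assms(2) by auto
  define e where "e = multiplicity 2 P"
  have "coprime Q P'" using assms(1) P'(1)
    by (metis coprime_commute coprime_mult_right_iff)
  moreover have "coprime (2 ^ n) P'" using P'(2) by simp
  ultimately have "gcd (Q * 2 ^ n) P' = 1" by (simp add: coprime_iff_gcd_eq_1[symmetric])
  then obtain r w where rw: "r * (Q * 2 ^ n) + w * P' = 1" using bezout_int[of "Q * 2 ^ n" P'] by metis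
  have "P' \<noteq> 0" using P'(2) by auto
  have "(r * m) * (Q * 2 ^ n) - m = - (w * m * P')"
    using arg_cong[OF rw, of "\<lambda>i. m * i"] by (simp add: algebra_simps)
  from arg_cong[OF this, of real_of_int]
  have *: "of_int (r * m) * (of_int Q * 2 ^ n) - of_int m = - (of_int w * of_int m * of_int P' :: real)"
    by (simp only: of_int_diff of_int_minus of_int_mult of_int_numeral of_int_power)
  have "of_int Q * of_int (r * m) - J = (of_int (r * m) * (of_int Q * 2 ^ n) - of_int m) / 2 ^ n"
    unfolding J by (simp add: diff_divide_distrib)
  then have "of_int Q * of_int (r * m) - J = - (of_int w * of_int m * of_int P') / 2 ^ n"
    unfolding * .
  moreover have "(of_int P :: real) = 2 ^ e * of_int P'"
    using arg_cong[OF P'(1), of real_of_int]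
    unfolding e_def by (simp only: of_int_mult of_int_numeral of_int_power)
  ultimately have "(of_int Q * of_int (r * m) - J) / of_int P = of_int (- (w * m)) / 2 ^ (n + e)"
    using \<open>P' \<noteq> 0\<close> by (simp add: power_add)
  then show thesis using that[of "r * m"] unfolding dyadic_rational_def by blast
qed

text \<open>At the abscissa \<open>k\<close> the line has ordinate \<open>(Q k - J) / P\<close>, and a suitable \<open>k\<close> makes it dyadic. A
  vertical line with dyadic \<open>J = \<plusminus> x\<close> crosses all horizontal grid lines at the dyadic abscissa
  \<open>x\<close>.\<close>

lemma rational_line_dyadic_crossing:
  fixes P Q :: int and l x y :: real
  assumes "coprime P Q" "l \<noteq> 0" "dyadic_rational (of_int Q * x - of_int P * y)"
  obtains t where "x + t * (l * of_int P) \<in> grid 1 \<and> dyadic_rational (y + t * (l * of_int Q)) \<or>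
    y + t * (l * of_int Q) \<in> grid 1 \<and> dyadic_rational (x + t * (l * of_int P))"
proof (cases "P = 0")
  case False
  obtain k :: int where k: "dyadic_rational ((of_int Q * of_int k - (of_int Q * x - of_int P * y)) / of_int P)"
    using coprime_line_dyadic_point[OF assms(1) False assms(3)] .
  define t where "t = (of_int k - x) / (l * of_int P)"
  have "x + t * (l * of_int P) = 1 * of_int k" using False assms(2) by (simp add: t_def)
  moreover have "y + t * (l * of_int Q) = (of_int Q * of_int k - (of_int Q * x - of_int P * y)) / of_int P"
    using False assms(2) by (simp add: t_def field_simps)
  ultimately show thesis using that[of t] k grid_of_int[of 1 k] by simp
next
  case True
  then have Q: "Q = 1 \<or> Q = - 1" using assms(1) by auto
  define t where "t = - y / (l * of_int Q)"
  have "y + t * (l * of_int Q) = 1 * of_int 0" using Q assms(2) by (auto simp: t_def)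
  moreover have "dyadic_rational x"
    using Q assms(3) True grid_minus by (fastforce simp: dyadic_rational_iff_grid)
  ultimately show thesis using that[of t] True grid_of_int[of 1 0] by simp
qed

text \<open>Over one period of length \<open>T\<close> the unfolded line advances by integers \<open>(A, B)\<close>, and \<open>(P, Q)\<close> arises
  from them by dividing by their gcd. Every crossing of the line with an integer grid line happens
  at a collision with the square, since the open square contains no point with an integral
  coordinate. So a crossing with an integral and a dyadic coordinate would produce a footprint
  point at a dyadic position.\<close>

lemma square_periodic_orbit_rational_line:
  assumes c: "fst c \<in> \<int>" "snd c \<in> \<int>"
    and ic: "initial_condition (unit_square c) ((x, y), (u, v))" (is "initial_condition ?Q ?z")
    and per: "periodic_orbit (unit_square c) ((x, y), (u, v))"
    and nd: "\<forall>p \<in> footprint (unit_square c) ((x, y), (u, v)).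
      \<forall>a \<in> side_positions c p. \<not> dyadic_rational a"
  obtains P Q :: int and l :: real
  where "u = l * of_int P" "v = l * of_int Q" "\<not> dyadic_rational (of_int Q * x - of_int P * y)"
proof -
  have g: "grid_region 1 ?Q" by (rule grid_region_unit_square[OF c])
  then have comp: "compact ?Q" by (simp add: grid_region_def)
  have fr_sub: "frontier ?Q \<subseteq> ?Q" using compact_imp_closed[OF comp] frontier_subset_eq by blast
  have cg: "fst c \<in> grid 1" "snd c \<in> grid 1" using c by (auto simp: grid_def elim: Ints_cases)
  have side: "a = b \<or> a = b + 1" if "a \<in> grid 1" "b \<in> grid 1" "b \<le> a" "a \<le> b + 1" for a b
    using that by (auto elim!: gridE)
  \<comment> \<open>No footprint point has one integral and one dyadic coordinate.\<close>
  have key: "\<not> (fst p \<in> grid 1 \<and> dyadic_rational (snd p))" "\<not> (snd p \<in> grid 1 \<and> dyadic_rational (fst p))"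
    if "p = fst (billiard_orbit ?Q ?z k)" "p \<in> ?Q" for p k
  proof -
    have nd': "\<not> dyadic_rational a" if "a \<in> side_positions c p" for a
      using nd that \<open>p = _\<close> unfolding footprint_def by blast
    have b: "fst c \<le> fst p" "fst p \<le> fst c + 1" "snd c \<le> snd p" "snd p \<le> snd c + 1"
      using \<open>p \<in> ?Q\<close> by (auto simp: unit_square_def mem_Times_iff)
    show "\<not> (fst p \<in> grid 1 \<and> dyadic_rational (snd p))"
      using nd'[of "snd p - snd c"] side[of "fst p" "fst c"] b cg dyadic_rational_diff_int
      by (auto simp: side_positions_def)
    show "\<not> (snd p \<in> grid 1 \<and> dyadic_rational (fst p))"
      using nd'[of "fst p - fst c"] side[of "snd p" "snd c"] b cg dyadic_rational_diff_int
      by (auto simp: side_positions_def)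
  qed
  have gd: "dyadic_rational a" if "a \<in> grid 1" for a
    using that grid_one_subset[of 0] unfolding dyadic_rational_iff_grid by blast
  have nv: "p \<notin> grid 1 \<times> grid 1" if "p = fst (billiard_orbit ?Q ?z k)" "p \<in> ?Q" for p k
    using key[OF that] gd by (auto simp: mem_Times_iff)
  have "(x, y) \<in> ?Q" using ic fr_sub by (auto simp: initial_condition_def)
  then have inw: "inward ?Q ?z"
    using nv[of "(x, y)" 0] inward_initial_condition[OF g ic] by (simp add: billiard_orbit_def)
  have step: "fst (billiard_orbit ?Q ?z (Suc k)) \<notin> grid 1 \<times> grid 1"
    if "inward ?Q (billiard_orbit ?Q ?z k)" for k
  proof (rule nv[OF refl])
    show "fst (billiard_orbit ?Q ?z (Suc k)) \<in> ?Q"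
      using hit_time_first_exit(2)[OF comp that] fr_sub
      unfolding billiard_orbit_Suc fst_billiard_map by blast
  qed
  have orbit: "inward ?Q (billiard_orbit ?Q ?z k)"
    "unfolds_to 1 ?z (elapsed_time ?Q ?z k) (billiard_orbit ?Q ?z k)" for k
    using billiard_orbit_unfolds[OF g inw step, of k] by simp_all
  have pos: "fst (billiard_orbit ?Q ?z k) \<in> ?Q" for k
    using orbit(1)[of k] flat_at_frontier fr_sub unfolding inward_def by blast
  obtain m where m: "m \<ge> 1" "billiard_orbit ?Q ?z m = ?z"
    using per by (auto simp: periodic_orbit_def)
  define T where "T = elapsed_time ?Q ?z m"
  have T: "T > 0" unfolding T_def elapsed_time_def
    using m(1) by (intro sum_pos hit_time_first_exit(1)[OF comp] orbit)
      (auto simp: lessThan_empty_iff)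
  have "T * u \<in> grid 1" "T * v \<in> grid 1"
    using orbit(2)[of m] m(2) folded_return by (auto simp: unfolds_to_def T_def)
  then obtain A B :: int where A: "T * u = of_int A" and B: "T * v = of_int B"
    by (auto elim!: gridE)
  have "norm (u, v) = 1" using ic by (simp add: initial_condition_def)
  then have "\<not> (A = 0 \<and> B = 0)" using A B T by (auto simp: norm_prod_def)
  then obtain P Q where PQ: "A = gcd A B * P" "B = gcd A B * Q" "coprime P Q"
    using gcd_coprime_exists[of A B] by (metis gcd_eq_0_iff mult.commute)
  define l where "l = of_int (gcd A B) / T"
  have l0: "l \<noteq> 0" using \<open>\<not> (A = 0 \<and> B = 0)\<close> T by (simp add: l_def)
  have uv: "u = l * of_int P" "v = l * of_int Q"
    using A B T arg_cong[OF PQ(1), of real_of_int] arg_cong[OF PQ(2), of real_of_int]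
    by (simp_all add: l_def field_simps)
  have "\<not> dyadic_rational (of_int Q * x - of_int P * y)"
  proof
    assume "dyadic_rational (of_int Q * x - of_int P * y)"
    from rational_line_dyadic_crossing[OF PQ(3) l0 this]
    obtain t0 where t0: "x + t0 * u \<in> grid 1 \<and> dyadic_rational (y + t0 * v) \<or>
      y + t0 * v \<in> grid 1 \<and> dyadic_rational (x + t0 * u)" unfolding uv .
    \<comment> \<open>The line is periodic modulo the integer lattice, so the crossing may be moved into the
      first period.\<close>
    define j where "j = \<lfloor>t0 / T\<rfloor>"
    define t where "t = t0 - of_int j * T"
    have "of_int j \<le> t0 / T" "t0 / T < of_int j + 1" unfolding j_def by (auto simp: floor_correct)
    then have t: "0 \<le> t" "t < T" using T by (auto simp: t_def field_simps)
    have "x + t * u = (x + t0 * u) - 1 * of_int (j * A)" "y + t * v = (y + t0 * v) - 1 * of_int (j * B)"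
      using A B by (simp_all add: t_def algebra_simps)
    then have cross: "x + t * u \<in> grid 1 \<and> dyadic_rational (y + t * v) \<or>
      y + t * v \<in> grid 1 \<and> dyadic_rational (x + t * u)"
      using t0 grid_diff[OF _ grid_of_int] dyadic_rational_diff_int[OF _ grid_of_int] by metis
    have "\<exists>i<n. elapsed_time ?Q ?z i \<le> t \<and> t < elapsed_time ?Q ?z (Suc i)"
      if "t < elapsed_time ?Q ?z n" for n
      using that
    proof (induction n)
      case 0
      then show ?case using t by (simp add: elapsed_time_def)
    next
      case (Suc n)
      then show ?case by (cases "t < elapsed_time ?Q ?z n") (auto simp: less_Suc_eq)
    qed
    then obtain i where i: "elapsed_time ?Q ?z i \<le> t" "t < elapsed_time ?Q ?z (Suc i)"
      using t(2) unfolding T_def by blast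
    define w where "w = billiard_orbit ?Q ?z i"
    define \<tau> where "\<tau> = t - elapsed_time ?Q ?z i"
    have tau: "0 \<le> \<tau>" "\<tau> < hit_time ?Q w"
      using i by (simp_all add: \<tau>_def w_def elapsed_time_def)
    define q where "q = fst w + \<tau> *\<^sub>R snd w"
    have "unfolds_to 1 ?z t (q, snd w)"
      using unfolds_to_shift[OF orbit(2)[of i], of \<tau>] by (simp add: q_def w_def \<tau>_def)
    then have q_cross: "fst q \<in> grid 1 \<and> dyadic_rational (snd q) \<or>
      snd q \<in> grid 1 \<and> dyadic_rational (fst q)"
      using cross folded_grid_iff dyadic_rational_folded by (fastforce simp: unfolds_to_def)
    have "\<tau> = 0"
    proof (rule ccontr)
      assume "\<tau> \<noteq> 0"
      then have "q \<in> interior ?Q"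
        using hit_time_first_exit(3)[OF comp orbit(1)[of i], of \<tau>] tau by (simp add: q_def w_def)
      then have "fst c < fst q" "fst q < fst c + 1" "snd c < snd q" "snd q < snd c + 1"
        by (auto simp: unit_square_def interior_Times mem_Times_iff)
      then show False using q_cross side[of "fst q" "fst c"] side[of "snd q" "snd c"] cg by auto
    qed
    then have "q = fst (billiard_orbit ?Q ?z i)" by (simp add: q_def w_def)
    then show False using key[of q i] pos[of i] q_cross by auto
  qed
  then show thesis using that uv by blast
qed

section \<open>Compatible orbits of the prefractals\<close>

theorem theorem4p25:
  fixes c x0 :: point and \<theta>0 :: real and x :: "nat \<Rightarrow> point"
  assumes "tile_corner c"
    and "initial_condition (unit_square c) (x0, angle_dir \<theta>0)"
    and "periodic_orbit (unit_square c) (x0, angle_dir \<theta>0)"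
    and "\<forall>p \<in> footprint (unit_square c) (x0, angle_dir \<theta>0).
           \<forall>s \<in> side_positions c p. \<not> dyadic_rational s"
    and "initial_condition (T_region 0) (x0, angle_dir \<theta>0)"
    and "reflected_unfolding (T_region 0) (unit_square c) (x0, angle_dir \<theta>0)"
    and "compatible_sequence (\<lambda>n. (x n, angle_dir \<theta>0))"
    and "x 0 = x0"
  shows "\<forall>n. periodic_orbit (T_region n) (x n, angle_dir \<theta>0)"
proof
  fix n
  define u v where "u = cos \<theta>0" and "v = sin \<theta>0"
  have dir: "angle_dir \<theta>0 = (u, v)" by (simp add: angle_dir_def u_def v_def)
  have "fst c \<in> \<int>" "snd c \<in> \<int>" using assms(1) by (auto simp: tile_corner_def)
  then obtain P Q :: int and l where u: "u = l * of_int P" and v: "v = l * of_int Q"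
    and nd: "\<not> dyadic_rational (of_int Q * fst x0 - of_int P * snd x0)"
    using square_periodic_orbit_rational_line[of c "fst x0" "snd x0" u v] assms(2-4)
    unfolding dir prod.collapse by metis
  \<comment> \<open>The number \<open>\<tau>\<close> may be negative: compatibility only puts both points on one segment.\<close>
  have "\<exists>\<tau>. x n = x0 + \<tau> *\<^sub>R (u, v)"
  proof (cases n)
    case 0
    then show ?thesis using assms(8) by (intro exI[of _ 0]) (simp add: zero_prod_def)
  next
    case (Suc k)
    then obtain p L where "x n \<in> closed_segment p (p + L *\<^sub>R (u, v))"
      "x 0 \<in> closed_segment p (p + L *\<^sub>R (u, v))"
      using assms(7) unfolding compatible_sequence_def compatible_def dir Let_def
      by (metis fst_conv snd_conv zero_less_Suc)
    then obtain a b where "x n = p + (a * L) *\<^sub>R (u, v)" "x 0 = p + (b * L) *\<^sub>R (u, v)"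
      by (auto simp: closed_segment_def algebra_simps)
    then have "x n = x0 + (a * L - b * L) *\<^sub>R (u, v)"
      using assms(8) by (simp add: algebra_simps)
    then show ?thesis ..
  qed
  then obtain \<tau> where "x n = x0 + \<tau> *\<^sub>R (u, v)" ..
  then have "of_int Q * fst (x n) - of_int P * snd (x n) = of_int Q * fst x0 - of_int P * snd x0"
    by (simp add: u v algebra_simps)
  then have "of_int Q * fst (x n) - of_int P * snd (x n) \<notin> grid (1 / 2 ^ n)"
    using nd by (auto simp: dyadic_rational_iff_grid)
  moreover have "initial_condition (T_region n) (x n, angle_dir \<theta>0)"
    using assms(7) by (simp add: compatible_sequence_def)
  ultimately show "periodic_orbit (T_region n) (x n, angle_dir \<theta>0)"
    using periodic_orbit_rational_line[OF grid_region_T_region, of n "fst (x n)" "snd (x n)" l P Q]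
    by (simp add: dir u v)
qed

end
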